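(* Let $\mathcal{C}$ be a binary clone with $\mathcal{O}^{(1)}\subseteq\mathcal{C}\subseteq T_2$. If $\mathcal{C}$ is a Borel set, or even just an analytic set, in $\mathcal{O}^{(2)}$, then $\mathcal{C}$ is not a coatom in the interval $[\mathcal{O}^{(1)},T_2]$ of the lattice of binary clones.
   Context: $\mathbb{N}=\{0,1,2,\dots\}$; $\mathcal{O}^{(2)}=\mathbb{N}^{\mathbb{N}^2}$ is the set of all binary operations on $\mathbb{N}$, with the product topology ($\mathbb{N}$ discrete). A binary clone is a set $\mathcal{C}\subseteq\mathcal{O}^{(2)}$ which contains the two projections and is closed under composition: if $f,g,h\in\mathcal{C}$, then the function $(x,y)\mapsto f(g(x,y),h(x,y))$ is in $\mathcal{C}$. Binary clones are ordered by inclusion. $\mathcal{O}^{(1)}$ denotes the set of unary functions $u:\mathbb{N}\to\mathbb{N}$, identified with the set of essentially unary functions; thus, for binary clones, "containing $\mathcal{O}^{(1)}$" means containing all functions $(x,y)\mapsto u(x)$ and $(x,y)\mapsto u(y)$ with $u:\mathbb{N}\to\mathbb{N}$ arbitrary. The interval $[\mathcal{O}^{(1)},T_2]$ consists of all binary clones $\mathcal{C}$ with $\mathcal{O}^{(1)}\subseteq\mathcal{C}\subseteq T_2$; a coatom of it is a maximal element of $[\mathcal{O}^{(1)},T_2]\setminus\{T_2\}$. Let $\Delta=\{(x,y)\in\mathbb{N}^2:x>y\}$, $\nabla=\{(x,y)\in\mathbb{N}^2:x<y\}$, and for $S_1,S_2\subseteq\mathbb{N}$ let $\Delta_{S_1,S_2}=\Delta\cap(S_1\times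 S_2)$, $\nabla_{S_1,S_2}=\nabla\cap(S_1\times S_2)$. For infinite $S_1,S_2\subseteq\mathbb{N}$, a function $g:\Delta_{S_1,S_2}\to\mathbb{N}$ or $g:\nabla_{S_1,S_2}\to\mathbb{N}$ is canonical if one of the following holds: (1) $g$ is constant; (2) there is a 1-1 function $G:S_1\to\mathbb{N}$ with $g(x,y)=G(x)$ for all $(x,y)\in\mathrm{dom}(g)$; (3) there is a 1-1 function $G:S_2\to\mathbb{N}$ with $g(x,y)=G(y)$ for all $(x,y)\in\mathrm{dom}(g)$; (4) $g$ is 1-1. A function $f:\mathbb{N}\times\mathbb{N}\to\mathbb{N}$ is canonical on $S_1\times S_2$ (with $S_1,S_2$ infinite) if both restrictions $f|_{\Delta_{S_1,S_2}}$ and $f|_{\nabla_{S_1,S_2}}$ are canonical (not necessarily of the same kind), and moreover either the ranges of these two restrictions are disjoint, or $S_1=S_2$ and $f(x,y)=f(y,x)$ for all $x,y\in S_1$. A function $f:\mathbb{N}\times\mathbb{N}\to\mathbb{N}$ is nowhere injective if, whenever $f$ is canonical on $S_1\times S_2$ (for infinite $S_1,S_2$), neither $f|_{\Delta_{S_1,S_2}}$ nor $f|_{\nabla_{S_1,S_2}}$ is 1-1. $T_2$ is the set of all nowhere injective functions; it is a binary clone containing $\mathcal{O}^{(1)}$. *)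

theory Defs
  imports "HOL-Analysis.Analysis"
begin

(* The library's topology on a function type is the product topology, and nat is discrete;
   so borel on binop is the Borel sigma-algebra of N^(N x N). *)
type_synonym binop = "nat \<times> nat \<Rightarrow> nat"

definition binary_clone :: "binop set \<Rightarrow> bool" where
  "binary_clone C \<longleftrightarrow>
     fst \<in> C \<and> snd \<in> C \<and>
     (\<forall>f\<in>C. \<forall>g\<in>C. \<forall>h\<in>C. (\<lambda>(x, y). f (g (x, y), h (x, y))) \<in> C)"

definition essentially_unary :: "binop set" where
  "essentially_unary =
     {(\<lambda>(x, y). u x) | u :: nat \<Rightarrow> nat. True} \<union> {(\<lambda>(x, y). u y) | u :: nat \<Rightarrow> nat. True}"

definition Delta :: "nat set \<Rightarrow> nat set \<Rightarrow> (nat \<times> nat) set" where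
  "Delta S1 S2 = {(x, y). x > y} \<inter> (S1 \<times> S2)"

definition Nabla :: "nat set \<Rightarrow> nat set \<Rightarrow> (nat \<times> nat) set" where
  "Nabla S1 S2 = {(x, y). x < y} \<inter> (S1 \<times> S2)"

(* Partial functions are total ones considered only on a set D, which is
   Delta S1 S2 or Nabla S1 S2 in all uses. *)
definition canonical :: "nat set \<Rightarrow> nat set \<Rightarrow> (nat \<times> nat) set \<Rightarrow> binop \<Rightarrow> bool" where
  "canonical S1 S2 D g \<longleftrightarrow>
     (\<exists>c. \<forall>(x, y)\<in>D. g (x, y) = c) \<or>
     (\<exists>G :: nat \<Rightarrow> nat. inj_on G S1 \<and> (\<forall>(x, y)\<in>D. g (x, y) = G x)) \<or>
     (\<exists>G :: nat \<Rightarrow> nat. inj_on G S2 \<and> (\<forall>(x, y)\<in>D. g (x, y) = G y)) \<or>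
     inj_on g D"

definition canonical_on :: "nat set \<Rightarrow> nat set \<Rightarrow> binop \<Rightarrow> bool" where
  "canonical_on S1 S2 f \<longleftrightarrow>
     infinite S1 \<and> infinite S2 \<and>
     canonical S1 S2 (Delta S1 S2) f \<and>
     canonical S1 S2 (Nabla S1 S2) f \<and>
     (f ` Delta S1 S2 \<inter> f ` Nabla S1 S2 = {} \<or>
      S1 = S2 \<and> (\<forall>x\<in>S1. \<forall>y\<in>S1. f (x, y) = f (y, x)))"

definition nowhere_injective :: "binop \<Rightarrow> bool" where
  "nowhere_injective f \<longleftrightarrow>
     (\<forall>S1 S2. canonical_on S1 S2 f \<longrightarrow>
        \<not> inj_on f (Delta S1 S2) \<and> \<not> inj_on f (Nabla S1 S2))"

definition T2 :: "binop set" where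
  "T2 = {f. nowhere_injective f}"

definition clone_interval :: "binop set \<Rightarrow> binop set \<Rightarrow> binop set set" where
  "clone_interval A B = {C. binary_clone C \<and> A \<subseteq> C \<and> C \<subseteq> B}"

definition coatom_of_clone_interval :: "binop set \<Rightarrow> binop set \<Rightarrow> binop set \<Rightarrow> bool" where
  "coatom_of_clone_interval A B C \<longleftrightarrow>
     C \<in> clone_interval A B - {B} \<and>
     (\<forall>D \<in> clone_interval A B - {B}. C \<subseteq> D \<longrightarrow> D = C)"

(* Empty or a continuous image of the Baire space nat => nat; intended for Polish spaces. *)
definition analytic_set :: "'a::topological_space set \<Rightarrow> bool" where
  "analytic_set A \<longleftrightarrow>
     A = {} \<or> (\<exists>\<phi> :: (nat \<Rightarrow> nat) \<Rightarrow> 'a. continuous_on UNIV \<phi> \<and> A = range \<phi>)"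

end

(*
  If an analytic clone C were a coatom, pick f in T2 outside C. The clone generated by C and f is a
  countable union of sets obtained from C by composition, hence analytic; it lies in T2, since T2 is
  closed under composition, and it properly contains C. So it would be T2, but T2 is not analytic.

  Both facts about T2 rest on Ramsey's theorem for 4-element sets: f is outside T2 iff for some
  sequences a, b the map f(a_i, b_j) is injective on all pairs i < j or on all pairs i > j. For the
  second fact, a tree T of finite sequences is mapped to an operation which is in T2 iff T is well
  founded. If T2 were the projection of a closed set F, one could build by recursion on the length
  of the sequences a tree T whose branches are the witnesses that its own operation is in T2, so
  that T would be well founded iff it is not.
*)
theory Submission
  imports Defs "HOL-Library.Nat_Bijection" "HOL-Library.Sublist" "HOL-Library.Ramsey"
begin

section \<open>Analytic sets of binary operations\<close>

lemma tendsto_fun_nat_iff: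
  fixes X :: "nat \<Rightarrow> 'a \<Rightarrow> nat"
  shows "X \<longlonglongrightarrow> L \<longleftrightarrow> (\<forall>p. \<forall>\<^sub>F n in sequentially. X n p = L p)"
proof -
  have "X \<longlonglongrightarrow> L \<longleftrightarrow> (\<forall>p. (\<lambda>n. X n p) \<longlonglongrightarrow> L p)"
    using limitin_componentwise[of "\<lambda>_. euclidean" UNIV X L sequentially]
    by (simp add: euclidean_product_topology)
  then show ?thesis
    by (simp add: tendsto_discrete)
qed

text \<open>Sequences detect closedness because the space is first countable, and convergence means
  that every coordinate is eventually equal to that of the limit. Closedness thus becomes a matter
  of single coordinates.\<close>

lemma closed_pairs_iff:
  fixes F :: "(binop \<times> (nat \<Rightarrow> nat)) set"
  shows "closed F \<longleftrightarrow>
    (\<forall>X Z f z. (\<forall>n. (X n, Z n) \<in> F) \<longrightarrow> (\<forall>p. \<forall>\<^sub>F n in sequentially. X n p = f p) \<longrightarrow>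
      (\<forall>k. \<forall>\<^sub>F n in sequentially. Z n k = z k) \<longrightarrow> (f, z) \<in> F)" (is "_ = ?R")
proof
  assume F: "closed F"
  show ?R
  proof (intro allI impI)
    fix X Z f z
    assume XZ: "\<forall>n. (X n, Z n) \<in> F"
      and "\<forall>p. \<forall>\<^sub>F n in sequentially. X n p = f p"
      and "\<forall>k. \<forall>\<^sub>F n in sequentially. Z n k = z k"
    then have "(\<lambda>n. (X n, Z n)) \<longlonglongrightarrow> (f, z)"
      by (intro tendsto_Pair tendsto_fun_nat_iff[THEN iffD2])
    then show "(f, z) \<in> F"
      using closed_sequentially[OF F, of "\<lambda>n. (X n, Z n)" "(f, z)"] XZ by blast
  qed
next
  assume R: ?R
  show "closed F"
    unfolding closed_sequential_limits
  proof (intro allI impI, elim conjE)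
    fix x l assume "\<forall>n. x n \<in> F" "x \<longlonglongrightarrow> l"
    then show "l \<in> F"
      using R[rule_format, of "fst \<circ> x" "snd \<circ> x" "fst l" "snd l"]
        tendsto_fst[of x l sequentially] tendsto_snd[of x l sequentially]
      by (simp add: tendsto_fun_nat_iff del: split_paired_All)
  qed
qed

lemmas closed_pairsI = closed_pairs_iff[THEN iffD2, rule_format]
lemmas closed_pairsD = closed_pairs_iff[THEN iffD1, rule_format]

text \<open>Projections of closed sets: unlike continuous images of the Baire space, these are closed under
  countable unions and intersections without first retracting the Baire space onto its closed subsets.\<close>

definition analytic :: "binop set \<Rightarrow> bool" where
  "analytic A \<longleftrightarrow> (\<exists>F :: (binop \<times> (nat \<Rightarrow> nat)) set. closed F \<and> A = fst ` F)"

lemma analyticI: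
  fixes F :: "(binop \<times> (nat \<Rightarrow> nat)) set"
  assumes "closed F" "\<And>f. f \<in> A \<longleftrightarrow> (\<exists>z. (f, z) \<in> F)"
  shows "analytic A"
  unfolding analytic_def using assms by (intro exI[of _ F]) force

lemma analyticD:
  assumes "analytic A"
  shows "\<exists>F :: (binop \<times> (nat \<Rightarrow> nat)) set. closed F \<and> (\<forall>f. f \<in> A \<longleftrightarrow> (\<exists>z. (f, z) \<in> F))"
  using assms unfolding analytic_def by force

lemma analytic_familyD:
  assumes "\<And>i. analytic (A i)"
  shows "\<exists>F :: 'i \<Rightarrow> (binop \<times> (nat \<Rightarrow> nat)) set.
    \<forall>i. closed (F i) \<and> (\<forall>f. f \<in> A i \<longleftrightarrow> (\<exists>z. (f, z) \<in> F i))"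
  by (intro choice allI analyticD assms)

lemma closed_imp_analytic:
  assumes "closed A"
  shows "analytic A"
  by (rule analyticI[of "A \<times> UNIV"]) (auto intro: closed_Times assms)

text \<open>A continuous image is the projection of the graph of the map, and the graph is
  closed.\<close>

lemma analytic_set_imp_analytic:
  assumes "analytic_set A"
  shows "analytic A"
proof (cases "A = {}")
  case True
  then show ?thesis by (simp add: closed_imp_analytic)
next
  case False
  then obtain \<phi> :: "(nat \<Rightarrow> nat) \<Rightarrow> binop" where \<phi>: "continuous_on UNIV \<phi>" "A = range \<phi>"
    using assms unfolding analytic_set_def by blast
  have "closed {(f, z). f = \<phi> z}"
  proof (rule closed_pairsI)
    fix X :: "nat \<Rightarrow> binop" and Z :: "nat \<Rightarrow> nat \<Rightarrow> nat" and f z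
    assume XZ: "\<And>n. (X n, Z n) \<in> {(f, z). f = \<phi> z}"
      and X: "\<And>p. \<forall>\<^sub>F n in sequentially. X n p = f p"
      and Z: "\<And>k. \<forall>\<^sub>F n in sequentially. Z n k = z k"
    have "Z \<longlonglongrightarrow> z" using Z by (simp add: tendsto_fun_nat_iff)
    then have "(\<lambda>n. \<phi> (Z n)) \<longlonglongrightarrow> \<phi> z"
      using \<phi>(1) continuous_on_tendsto_compose[of UNIV \<phi> Z z sequentially] by simp
    moreover have "(\<lambda>n. \<phi> (Z n)) = X" using XZ by auto
    ultimately have lim: "\<forall>\<^sub>F n in sequentially. X n p = \<phi> z p" for p
      by (simp add: tendsto_fun_nat_iff del: split_paired_All)
    have "f p = \<phi> z p" for p
    proof -
      have "\<forall>\<^sub>F n in sequentially. f p = \<phi> z p"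
        using X[of p] lim[of p] by eventually_elim simp
      then show ?thesis by simp
    qed
    then show "(f, z) \<in> {(f, z). f = \<phi> z}" by auto
  qed
  then show ?thesis
    by (rule analyticI) (auto simp: \<phi>(2))
qed

text \<open>The pairing of indices turns one point of the Baire space into a sequence of such
  points, so that one witness can carry countably many.\<close>

definition slice :: "(nat \<Rightarrow> nat) \<Rightarrow> nat \<Rightarrow> nat \<Rightarrow> nat" where
  "slice z i n = z (prod_encode (i, n))"

lemma slice_surj: "\<exists>z. \<forall>i. slice z i = w i"
  by (rule exI[of _ "\<lambda>k. case prod_decode k of (i, n) \<Rightarrow> w i n"]) (auto simp: slice_def)

lemma eventually_slice:
  assumes "\<And>k. \<forall>\<^sub>F n in sequentially. Z n k = z k"
  shows "\<forall>\<^sub>F n in sequentially. slice (Z n) i k = slice z i k"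
  unfolding slice_def by (rule assms)

text \<open>A witness for the intersection stores in slice \<open>i\<close> a witness for
  \<open>A i\<close>; the condition is closed since every slice depends continuously on
  \<open>z\<close>.\<close>

lemma analytic_INT:
  fixes A :: "nat \<Rightarrow> binop set"
  assumes "\<And>i. analytic (A i)"
  shows "analytic (\<Inter>i. A i)"
proof -
  obtain F :: "nat \<Rightarrow> (binop \<times> (nat \<Rightarrow> nat)) set"
    where "\<forall>i. closed (F i) \<and> (\<forall>f. f \<in> A i \<longleftrightarrow> (\<exists>z. (f, z) \<in> F i))"
    using analytic_familyD[OF assms] ..
  then have F: "\<And>i. closed (F i)" "\<And>i f. f \<in> A i \<longleftrightarrow> (\<exists>z. (f, z) \<in> F i)" by auto
  let ?F = "{(f, z). \<forall>i. (f, slice z i) \<in> F i}"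
  have "closed ?F"
  proof (rule closed_pairsI)
    fix X :: "nat \<Rightarrow> binop" and Z :: "nat \<Rightarrow> nat \<Rightarrow> nat" and f z
    assume XZ: "\<And>n. (X n, Z n) \<in> ?F"
      and X: "\<And>p. \<forall>\<^sub>F n in sequentially. X n p = f p"
      and Z: "\<And>k. \<forall>\<^sub>F n in sequentially. Z n k = z k"
    have "(f, slice z i) \<in> F i" for i
      by (rule closed_pairsD[OF F(1), of X "\<lambda>n. slice (Z n) i"])
        (use XZ X Z eventually_slice in auto)
    then show "(f, z) \<in> ?F" by simp
  qed
  moreover have "f \<in> (\<Inter>i. A i) \<longleftrightarrow> (\<exists>z. (f, z) \<in> ?F)" for f
  proof
    assume "f \<in> (\<Inter>i. A i)"
    then obtain w where w: "\<And>i. (f, w i) \<in> F i" using F(2) by (metis INT_E UNIV_I)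
    obtain z where "\<And>i. slice z i = w i" using slice_surj by metis
    then have "slice z = w" by (rule ext)
    then have "(f, z) \<in> ?F" using w by simp
    then show "\<exists>z. (f, z) \<in> ?F" by blast
  qed (use F(2) in auto)
  ultimately show ?thesis by (rule analyticI)
qed

text \<open>The entry \<open>z 0\<close> names a member of the family, and the rest of
  \<open>z\<close> is a witness for it.\<close>

lemma analytic_UN:
  fixes A :: "nat \<Rightarrow> binop set"
  assumes "\<And>i. analytic (A i)"
  shows "analytic (\<Union>i. A i)"
proof -
  obtain F :: "nat \<Rightarrow> (binop \<times> (nat \<Rightarrow> nat)) set"
    where "\<forall>i. closed (F i) \<and> (\<forall>f. f \<in> A i \<longleftrightarrow> (\<exists>z. (f, z) \<in> F i))"
    using analytic_familyD[OF assms] ..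
  then have F: "\<And>i. closed (F i)" "\<And>i f. f \<in> A i \<longleftrightarrow> (\<exists>z. (f, z) \<in> F i)" by auto
  let ?F = "{(f, z). (f, z \<circ> Suc) \<in> F (z 0)}"
  have "closed ?F"
  proof (rule closed_pairsI)
    fix X :: "nat \<Rightarrow> binop" and Z :: "nat \<Rightarrow> nat \<Rightarrow> nat" and f z
    assume XZ: "\<And>n. (X n, Z n) \<in> ?F"
      and X: "\<And>p. \<forall>\<^sub>F n in sequentially. X n p = f p"
      and Z: "\<And>k. \<forall>\<^sub>F n in sequentially. Z n k = z k"
    \<comment> \<open>From \<open>N\<close> on all terms refer to the same closed set
      \<open>F (z 0)\<close>, which therefore contains the limit.\<close>
    obtain N where N: "\<And>n. n \<ge> N \<Longrightarrow> Z n 0 = z 0"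
      using Z[of 0] by (auto simp: eventually_sequentially)
    have "(f, z \<circ> Suc) \<in> F (z 0)"
    proof (rule closed_pairsD[OF F(1), of "\<lambda>n. X (n + N)" "\<lambda>n. Z (n + N) \<circ> Suc"])
      show "(X (n + N), Z (n + N) \<circ> Suc) \<in> F (z 0)" for n
        using XZ[of "n + N"] N[of "n + N"] by simp
      show "\<forall>\<^sub>F n in sequentially. X (n + N) p = f p" for p
        using X[of p] by (subst eventually_sequentially_seg)
      show "\<forall>\<^sub>F n in sequentially. (Z (n + N) \<circ> Suc) k = (z \<circ> Suc) k" for k
        using Z[of "Suc k"] unfolding o_def
        by (subst eventually_sequentially_seg[of "\<lambda>n. Z n (Suc k) = z (Suc k)"])
    qed
    then show "(f, z) \<in> ?F" by simp
  qed
  moreover have "f \<in> (\<Union>i. A i) \<longleftrightarrow> (\<exists>z. (f, z) \<in> ?F)" for f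
  proof
    assume "f \<in> (\<Union>i. A i)"
    then obtain i z where "(f, z) \<in> F i" using F(2) by auto
    then have "(f, case_nat i z) \<in> ?F" by (simp add: o_def)
    then show "\<exists>z. (f, z) \<in> ?F" by blast
  qed (use F(2) in auto)
  ultimately show ?thesis by (rule analyticI)
qed

lemma analytic_Un:
  assumes "analytic A" "analytic B"
  shows "analytic (A \<union> B)"
proof -
  have "A \<union> B = (\<Union>i::nat. if i = 0 then A else B)" by auto
  then show ?thesis using analytic_UN[of "\<lambda>i. if i = 0 then A else B"] assms by simp
qed

section \<open>Open and Borel sets as projections of closed sets\<close>

lemma open_imp_analytic:
  assumes "open (U :: binop set)"
  shows "analytic U"
proof -
  \<comment> \<open>the basic clopen neighbourhoods fixing the first \<open>n\<close> coordinates that are contained in \<open>U\<close>\<close>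
  let ?V = "\<lambda>n. {x. \<forall>y. (\<forall>p. prod_encode p < n \<longrightarrow> y p = x p) \<longrightarrow> y \<in> U}"
  have "closed (?V n)" for n
    unfolding closed_sequential_limits
  proof (intro allI impI, elim conjE)
    fix x l assume x: "\<forall>k. x k \<in> ?V n" and "x \<longlonglongrightarrow> l"
    then have "\<forall>\<^sub>F k in sequentially. \<forall>p \<in> prod_decode ` {..<n}. x k p = l p"
      by (intro eventually_ball_finite) (auto simp: tendsto_fun_nat_iff simp del: split_paired_All)
    then obtain k where "\<forall>p \<in> prod_decode ` {..<n}. x k p = l p"
      using eventually_happens'[OF sequentially_bot] by blast
    then have "x k p = l p" if "prod_encode p < n" for p
      using that by (metis image_eqI lessThan_iff prod_encode_inverse)
    then have "\<forall>p. prod_encode p < n \<longrightarrow> y p = x k p" if "\<forall>p. prod_encode p < n \<longrightarrow> y p = l p" for y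
      using that by simp
    then show "l \<in> ?V n" using x by blast
  qed
  then have "analytic (\<Union>n. ?V n)" by (intro analytic_UN closed_imp_analytic)
  moreover have "U = (\<Union>n. ?V n)"
  proof
    show "U \<subseteq> (\<Union>n. ?V n)"
    proof (rule subsetI, rule ccontr)
      fix x assume "x \<in> U" "x \<notin> (\<Union>n. ?V n)"
      then have "\<forall>n. \<exists>y. (\<forall>p. prod_encode p < n \<longrightarrow> y p = x p) \<and> y \<notin> U"
        by (simp del: split_paired_All)
      then have "\<exists>y. \<forall>n. (\<forall>p. prod_encode p < n \<longrightarrow> y n p = x p) \<and> y n \<notin> U"
        by (rule choice)
      then obtain y where "\<forall>n. (\<forall>p. prod_encode p < n \<longrightarrow> y n p = x p) \<and> y n \<notin> U" ..
      then have y: "\<And>n p. prod_encode p < n \<Longrightarrow> y n p = x p" "\<And>n. y n \<notin> U"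
        by (simp_all del: split_paired_All)
      have "\<forall>\<^sub>F n in sequentially. y n p = x p" for p
        using y(1)[of p] by (intro eventually_sequentiallyI[of "Suc (prod_encode p)"]) simp
      then have "y \<longlonglongrightarrow> x"
        by (intro tendsto_fun_nat_iff[THEN iffD2] allI)
      then have "x \<in> - U"
        using closed_sequentially[of "- U" y x] assms y(2) by (auto simp: closed_def)
      then show False using \<open>x \<in> U\<close> by simp
    qed
  qed auto
  ultimately show ?thesis by simp
qed

text \<open>The sets that are analytic together with their complements form a sigma-algebra
  containing the open sets. The complement is carried along because analyticity alone does not pass
  to complements.\<close>

lemma borel_imp_analytic:
  assumes "(A :: binop set) \<in> sets borel"
  shows "analytic A"
proof -
  have "A \<in> sigma_sets UNIV {S. open S}"
    using assms by (simp add: borel_def sets_measure_of)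
  then have "analytic A \<and> analytic (- A)"
  proof (induction rule: sigma_sets.induct)
    case (Basic a)
    then show ?case by (auto intro: open_imp_analytic closed_imp_analytic closed_Compl)
  next
    case Empty
    then show ?case by (auto intro: closed_imp_analytic)
  next
    case (Compl a)
    then show ?case by (simp add: Compl_eq_Diff_UNIV[symmetric])
  next
    case (Union a)
    then have "analytic (\<Union>i. a i)" "analytic (\<Inter>i. - a i)"
      by (auto intro: analytic_UN analytic_INT)
    then show ?case by (simp only: Compl_UN)
  qed
  then show ?thesis ..
qed

section \<open>Clones generated by analytic sets\<close>

definition compositions :: "binop set \<Rightarrow> binop set" where
  "compositions A = {(\<lambda>(x, y). f (g (x, y), h (x, y))) | f g h. f \<in> A \<and> g \<in> A \<and> h \<in> A}"

text \<open>A single \<open>z\<close> codes the three operations in slices 0 to 2 and the witnesses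
  of their membership in slices 3 to 5.\<close>

lemma analytic_compositions:
  assumes "analytic A"
  shows "analytic (compositions A)"
proof -
  obtain F :: "(binop \<times> (nat \<Rightarrow> nat)) set"
    where "closed F \<and> (\<forall>f. f \<in> A \<longleftrightarrow> (\<exists>z. (f, z) \<in> F))"
    using analyticD[OF assms] ..
  then have F: "closed F" "\<And>f. f \<in> A \<longleftrightarrow> (\<exists>z. (f, z) \<in> F)" by auto
  define e :: "(nat \<Rightarrow> nat) \<Rightarrow> nat \<Rightarrow> binop" where "e z i = slice z i \<circ> prod_encode" for z i
  let ?F = "{(f, z). (e z 0, slice z 3) \<in> F \<and> (e z 1, slice z 4) \<in> F \<and> (e z 2, slice z 5) \<in> F
      \<and> f = (\<lambda>(x, y). e z 0 (e z 1 (x, y), e z 2 (x, y)))}"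
  have "closed ?F"
  proof (rule closed_pairsI)
    fix X :: "nat \<Rightarrow> binop" and Z :: "nat \<Rightarrow> nat \<Rightarrow> nat" and f z
    assume XZ: "\<And>n. (X n, Z n) \<in> ?F"
      and X: "\<And>p. \<forall>\<^sub>F n in sequentially. X n p = f p"
      and Z: "\<And>k. \<forall>\<^sub>F n in sequentially. Z n k = z k"
    have sl: "\<forall>\<^sub>F n in sequentially. slice (Z n) i k = slice z i k" for i k
      using eventually_slice[OF Z] .
    then have el: "\<forall>\<^sub>F n in sequentially. e (Z n) i p = e z i p" for i p
      by (simp add: e_def)
    have 1: "(e z i, slice z j) \<in> F" if "\<And>n. (e (Z n) i, slice (Z n) j) \<in> F" for i j
      by (rule closed_pairsD[OF F(1), of "\<lambda>n. e (Z n) i" "\<lambda>n. slice (Z n) j"])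
        (use that sl el in auto)
    \<comment> \<open>Composition is continuous: the inner values eventually settle, and from then
      on the outer operation is evaluated at one fixed argument.\<close>
    have "f (x, y) = e z 0 (e z 1 (x, y), e z 2 (x, y))" for x y
    proof -
      have "\<forall>\<^sub>F n in sequentially. f (x, y) = e z 0 (e z 1 (x, y), e z 2 (x, y))"
        using X[of "(x, y)"] el[of 1 "(x, y)"] el[of 2 "(x, y)"]
          el[of 0 "(e z 1 (x, y), e z 2 (x, y))"]
      proof eventually_elim
        case (elim n)
        have "X n (x, y) = e (Z n) 0 (e (Z n) 1 (x, y), e (Z n) 2 (x, y))"
          using XZ[of n] by simp
        then show ?case using elim by simp
      qed
      then show ?thesis by simp
    qed
    then have "f = (\<lambda>(x, y). e z 0 (e z 1 (x, y), e z 2 (x, y)))" by auto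
    then show "(f, z) \<in> ?F" using XZ 1 by auto
  qed
  moreover have "f \<in> compositions A \<longleftrightarrow> (\<exists>z. (f, z) \<in> ?F)" for f
  proof
    assume "f \<in> compositions A"
    then obtain a b c where f: "f = (\<lambda>(x, y). a (b (x, y), c (x, y)))"
      and "a \<in> A" "b \<in> A" "c \<in> A"
      unfolding compositions_def by blast
    then obtain za zb zc where zs: "(a, za) \<in> F" "(b, zb) \<in> F" "(c, zc) \<in> F"
      using F(2) by metis
    obtain z where z: "\<And>i. slice z i =
        (\<lambda>i. [a \<circ> prod_decode, b \<circ> prod_decode, c \<circ> prod_decode, za, zb, zc] ! i) i"
      using slice_surj by metis
    have "e z 0 = a" "e z 1 = b" "e z 2 = c" "slice z 3 = za" "slice z 4 = zb" "slice z 5 = zc"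
      by (simp_all add: e_def z o_def numeral_eq_Suc)
    then have "(f, z) \<in> ?F" using f zs by simp
    then show "\<exists>z. (f, z) \<in> ?F" by blast
  qed (use F(2) in \<open>auto simp: compositions_def\<close>)
  ultimately show ?thesis by (rule analyticI)
qed

text \<open>Countably many stages, so that analyticity can be proved stage by stage and then passed
  to the union.\<close>

primrec generated :: "binop set \<Rightarrow> nat \<Rightarrow> binop set" where
  "generated A 0 = A"
| "generated A (Suc n) = generated A n \<union> compositions (generated A n)"

lemma analytic_generated: "analytic A \<Longrightarrow> analytic (generated A n)"
  by (induction n) (auto intro: analytic_Un analytic_compositions)

lemma generated_mono: "m \<le> n \<Longrightarrow> generated A m \<subseteq> generated A n"
  by (rule lift_Suc_mono_le) auto

lemma generated_subset:
  assumes "A \<subseteq> B" "compositions B \<subseteq> B"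
  shows "generated A n \<subseteq> B"
proof (induction n)
  case (Suc n)
  then have "compositions (generated A n) \<subseteq> compositions B"
    unfolding compositions_def by blast
  then show ?case using Suc assms by auto
qed (use assms in auto)

text \<open>Three members of the union lie in a common stage, and the next stage contains their
  composition.\<close>

lemma binary_clone_generated:
  assumes "fst \<in> A" "snd \<in> A"
  shows "binary_clone (\<Union>n. generated A n)"
  unfolding binary_clone_def
proof (intro conjI ballI)
  fix f g h assume "f \<in> (\<Union>n. generated A n)" "g \<in> (\<Union>n. generated A n)" "h \<in> (\<Union>n. generated A n)"
  then obtain i j k where "f \<in> generated A i" "g \<in> generated A j" "h \<in> generated A k" by blast
  moreover define n where "n = i + j + k"
  ultimately have "f \<in> generated A n" "g \<in> generated A n" "h \<in> generated A n"
    using generated_mono[of i n A] generated_mono[of j n A] generated_mono[of k n A] by auto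
  then have "(\<lambda>(x, y). f (g (x, y), h (x, y))) \<in> generated A (Suc n)"
    by (auto simp: compositions_def)
  then show "(\<lambda>(x, y). f (g (x, y), h (x, y))) \<in> (\<Union>n. generated A n)" by blast
qed (use assms in \<open>auto intro: exI[of _ 0]\<close>)

section \<open>Indiscernible sequences and canonical functions\<close>

text \<open>Ramsey's theorem for 4-element sets, each coloured by the patterns of positions at which
  \<open>Q\<close> holds in its increasing listing; \<open>h\<close> enumerates a homogeneous
  set.\<close>

lemma indiscernible_subsequence:
  fixes Q :: "nat \<Rightarrow> nat \<Rightarrow> nat \<Rightarrow> nat \<Rightarrow> bool"
  shows "\<exists>h :: nat \<Rightarrow> nat. strict_mono h \<and> (\<forall>i j k l m. strict_mono_on {i, j, k, l} m \<longrightarrow>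
      Q (h i) (h j) (h k) (h l) = Q (h (m i)) (h (m j)) (h (m k)) (h (m l)))"
proof -
  define col where "col X = {(i, j, k, l). i < 4 \<and> j < 4 \<and> k < 4 \<and> l < (4::nat) \<and>
    (let s = sorted_list_of_set X in Q (s ! i) (s ! j) (s ! k) (s ! l))}" for X
  let ?B = "{..<4::nat} \<times> {..<4::nat} \<times> {..<4::nat} \<times> {..<4::nat}"
  have fin: "finite (Pow ?B)" by simp
  have colB: "col X \<in> Pow ?B" for X by (auto simp: col_def)
  \<comment> \<open>Ramsey's theorem is used with colours below a number, so the finitely many sets
    of patterns are numbered injectively.\<close>
  obtain c :: "_ \<Rightarrow> nat" and n where c: "c ` Pow ?B = {i. i < n}" "inj_on c (Pow ?B)"
    using finite_imp_inj_to_nat_seg[OF fin] by blast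
  have "c (col X) < n" for X using c(1) colB by blast
  then obtain Y t where Y: "infinite Y" "\<And>X. X \<subseteq> Y \<Longrightarrow> finite X \<Longrightarrow> card X = 4 \<Longrightarrow> c (col X) = t"
    using Ramsey[of "UNIV :: nat set" 4 "\<lambda>X. c (col X)" n] by auto
  define h where "h = enumerate Y"
  have h: "strict_mono h" "\<And>n. h n \<in> Y"
    using Y(1) by (auto simp: h_def strict_mono_enumerate enumerate_in_set)
  have "Q (h i) (h j) (h k) (h l) \<longleftrightarrow> Q (h (m i)) (h (m j)) (h (m k)) (h (m l))"
    if m: "strict_mono_on {i, j, k, l} m" for i j k l m
  proof -
    \<comment> \<open>If the four indices are not distinct, pad them above to a set of exactly four points.\<close>
    define A where "A = {i, j, k, l}"
    define M where "M = Suc (Max A)"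
    define K where "K = Suc (Max (m ` A))"
    define B where "B = A \<union> {M..<M + (4 - card A)}"
    \<comment> \<open>The padding points lie above \<open>A\<close> and are moved beyond all values
      of \<open>m\<close> on \<open>A\<close>, so that this extension of \<open>m\<close> stays
      strictly increasing on \<open>B\<close>.\<close>
    define m' where "m' n = (if n \<in> A then m n else n + K)" for n
    have finA: "finite A" and finB: "finite B" by (auto simp: A_def B_def)
    have M: "n < M" if "n \<in> A" for n
      using that finA by (simp add: M_def less_Suc_eq_le)
    have K: "m n < K" if "n \<in> A" for n
      using that finA by (simp add: K_def less_Suc_eq_le)
    have cA: "card A \<le> 4" unfolding A_def by (simp add: card_insert_if)
    have cB: "card B = 4"
      unfolding B_def using M finA cA by (subst card_Un_disjoint) force+
    have m'B: "strict_mono_on B m'"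
    proof (rule strict_mono_onI)
      fix r s assume "r \<in> B" "s \<in> B" "r < s"
      then show "m' r < m' s"
        using m M[of s] K[of r] unfolding m'_def B_def
        by (auto simp: A_def[symmetric] dest: strict_mono_onD)
    qed
    \<comment> \<open>Order-preserving maps commute with increasing listing, so an index keeps its
      position in the list when \<open>B\<close> is moved.\<close>
    have key: "sorted_list_of_set (g ` B) = map g (sorted_list_of_set B)"
      if "strict_mono_on B g" for g :: "nat \<Rightarrow> nat"
    proof (rule sorted_list_of_set.idem_if_sorted_distinct[THEN subst])
      show "sorted_wrt (\<le>) (map g (sorted_list_of_set B))"
        unfolding sorted_wrt_map
        by (rule sorted_wrt_mono_rel[OF _ sorted_sorted_list_of_set])
          (use that finB in \<open>auto dest: strict_mono_on_leD\<close>)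
      show "distinct (map g (sorted_list_of_set B))"
        using that finB by (simp add: distinct_map strict_mono_on_imp_inj_on)
    qed (use finB in simp)
    have colh: "c (col (g ` B)) = t" if "strict_mono_on B g" "range g \<subseteq> Y" for g
      using that finB cB by (intro Y(2)) (auto simp: card_image strict_mono_on_imp_inj_on)
    have g1: "strict_mono_on B h" and g2: "strict_mono_on B (h \<circ> m')"
      using h(1) m'B by (auto simp: monotone_on_def)
    have "c (col (h ` B)) = c (col ((h \<circ> m') ` B))"
      using colh[OF g1] colh[OF g2] h(2) by (simp add: image_subset_iff)
    then have eq: "col (h ` B) = col ((h \<circ> m') ` B)"
      using c(2) colB by (meson inj_onD)
    have idx: "\<exists>r<4. sorted_list_of_set B ! r = n" if "n \<in> A" for n
    proof -
      have "n \<in> set (sorted_list_of_set B)" using that finB by (simp add: B_def)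
      then show ?thesis using cB by (metis in_set_conv_nth length_sorted_list_of_set)
    qed
    obtain i' j' k' l' where lt: "i' < 4" "j' < 4" "k' < 4" "l' < 4"
      and s: "sorted_list_of_set B ! i' = i" "sorted_list_of_set B ! j' = j"
        "sorted_list_of_set B ! k' = k" "sorted_list_of_set B ! l' = l"
      using idx[of i] idx[of j] idx[of k] idx[of l] unfolding A_def by auto
    have "(i', j', k', l') \<in> col (g ` B) \<longleftrightarrow> Q (g i) (g j) (g k) (g l)" if "strict_mono_on B g" for g
      unfolding col_def key[OF that] using lt s cB by (simp add: Let_def)
    from this[OF g1] this[OF g2] eq show ?thesis
      by (simp add: m'_def A_def)
  qed
  with h(1) show ?thesis by blast
qed

section \<open>Canonical forms on increasing pairs\<close>

definition up :: "(nat \<times> nat) set" where "up = {(i, j). i < j}"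

text \<open>Whether \<open>g (i, j) = g (k, l)\<close> depends only on the order type of \<open>(i, j, k, l)\<close>.\<close>

definition indisc :: "binop \<Rightarrow> bool" where
  "indisc g \<longleftrightarrow> (\<forall>i j k l m. strict_mono_on {i, j, k, l} m \<longrightarrow>
      (g (i, j) = g (k, l) \<longleftrightarrow> g (m i, m j) = g (m k, m l)))"

lemma indiscD:
  assumes "indisc g" "strict_mono_on {i, j, k, l} m" "g (i, j) = g (k, l)"
  shows "g (m i, m j) = g (m k, m l)"
  using assms unfolding indisc_def by blast

lemma indisc_transpose:
  assumes "indisc g"
  shows "indisc (\<lambda>(i, j). g (j, i))"
  unfolding indisc_def
proof (intro allI impI)
  fix i j k l :: nat and m :: "nat \<Rightarrow> nat"
  assume "strict_mono_on {i, j, k, l} m"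
  then have "strict_mono_on {j, i, l, k} m" by (simp add: insert_commute)
  then show "(case (i, j) of (i, j) \<Rightarrow> g (j, i)) = (case (k, l) of (i, j) \<Rightarrow> g (j, i)) \<longleftrightarrow>
      (case (m i, m j) of (i, j) \<Rightarrow> g (j, i)) = (case (m k, m l) of (i, j) \<Rightarrow> g (j, i))"
    using assms unfolding indisc_def prod.case by blast
qed

lemma indisc_subsequence:
  fixes g :: binop
  obtains h where "strict_mono h" "indisc (\<lambda>(i, j). g (h i, h j))"
proof -
  obtain h :: "nat \<Rightarrow> nat" where "strict_mono h \<and> (\<forall>i j k l m. strict_mono_on {i, j, k, l} m \<longrightarrow>
      (g (h i, h j) = g (h k, h l)) = (g (h (m i), h (m j)) = g (h (m k), h (m l))))"
    using indiscernible_subsequence[of "\<lambda>i j k l. g (i, j) = g (k, l)"] ..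
  then show ?thesis by (intro that[of h]) (auto simp: indisc_def)
qed

text \<open>All increasing triples have the same order type, so one coincidence within a row spreads
  to all rows.\<close>

lemma indisc_row:
  assumes g: "indisc g" and eq: "g (a, b) = g (a, c)" "a < b" "b < c"
    and "i < j" "i < k"
  shows "g (i, j) = g (i, k)"
proof -
  have "g (i, j) = g (i, k)" if "i < j" "j < k" for i j k
  proof -
    let ?m = "\<lambda>n. if n = a then i else if n = b then j else k"
    have "strict_mono_on {a, b, a, c} ?m"
      using that eq by (auto simp: monotone_on_def)
    from indiscD[OF g this eq(1)] show ?thesis using eq by simp
  qed
  then show ?thesis using assms by (metis linorder_neqE_nat)
qed

lemma indisc_column:
  assumes g: "indisc g" and eq: "g (a, c) = g (b, c)" "a < b" "b < c"
    and "i < k" "j < k"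
  shows "g (i, k) = g (j, k)"
proof -
  have "g (i, k) = g (j, k)" if "i < j" "j < k" for i j k
  proof -
    let ?m = "\<lambda>n. if n = a then i else if n = b then j else k"
    have "strict_mono_on {a, c, b, c} ?m"
      using that eq by (auto simp: monotone_on_def)
    from indiscD[OF g this eq(1)] show ?thesis using eq by simp
  qed
  then show ?thesis using assms by (metis linorder_neqE_nat)
qed

text \<open>Doubling all indices makes room to move a single index without changing the order type.\<close>

lemma indisc_bump_fst:
  assumes g: "indisc g" and eq: "g (i, j) = g (k, l)" and "i \<noteq> j" "i \<noteq> k" "i \<noteq> l"
  shows "g (2 * i, 2 * j) = g (2 * i + 1, 2 * j)"
proof -
  have "strict_mono_on {i, j, k, l} (\<lambda>n. 2 * n)"
    "strict_mono_on {i, j, k, l} (\<lambda>n. if n = i then 2 * n + 1 else 2 * n)"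
    by (auto simp: monotone_on_def)
  from indiscD[OF g this(1) eq] indiscD[OF g this(2) eq] show ?thesis
    using assms(3-) by simp
qed

lemma indisc_bump_snd:
  assumes g: "indisc g" and eq: "g (i, j) = g (k, l)" and "j \<noteq> i" "j \<noteq> k" "j \<noteq> l"
  shows "g (2 * i, 2 * j) = g (2 * i, 2 * j + 1)"
proof -
  have "(case (2 * j, 2 * i) of (i, j) \<Rightarrow> g (j, i)) = (case (2 * j + 1, 2 * i) of (i, j) \<Rightarrow> g (j, i))"
    by (rule indisc_bump_fst[OF indisc_transpose[OF g], of j i l k]) (use assms in auto)
  then show ?thesis by simp
qed

text \<open>This is the Erdos-Rado canonical Ramsey theorem for pairs, after the passage to
  indiscernibles; the four cases record whether rows and whether columns are constant. In the column
  case 0 is never the larger index, so \<open>G\<close> is controlled only at positive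
  indices.\<close>

lemma erdos_rado_pairs:
  assumes g: "indisc g"
  obtains (const) c where "\<And>i j. i < j \<Longrightarrow> g (i, j) = c"
    | (row) G where "inj_on G {0<..}" "\<And>i j. i < j \<Longrightarrow> g (i, j) = G i"
    | (column) G where "inj_on G {0<..}" "\<And>i j. i < j \<Longrightarrow> g (i, j) = G j"
    | (inj) "inj_on g up"
proof -
  let ?row = "\<forall>i j k. i < j \<longrightarrow> i < k \<longrightarrow> g (i, j) = g (i, k)"
  let ?col = "\<forall>i j k. i < k \<longrightarrow> j < k \<longrightarrow> g (i, k) = g (j, k)"
  consider "?row" "?col" | "?row" "\<not> ?col" | "\<not> ?row" "?col" | "\<not> ?row" "\<not> ?col" by satx
  then show ?thesis
  proof cases
    case 1
    have "g (i, j) = g (0, 1)" if "i < j" for i j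
    proof -
      have "g (i, j) = g (i, Suc j)" using 1(1) that by (meson less_SucI)
      also have "\<dots> = g (0, Suc j)" using 1(2) that by (meson less_SucI zero_less_Suc)
      also have "\<dots> = g (0, 1)" using 1(1) by (meson zero_less_Suc zero_less_one)
      finally show ?thesis .
    qed
    then show ?thesis by (rule const)
  next
    case 2
    have neq: "g (i, Suc i) \<noteq> g (k, Suc k)" if "i < k" for i k
    proof
      assume "g (i, Suc i) = g (k, Suc k)"
      moreover have "g (i, Suc i) = g (i, Suc k)"
        using 2(1) that by (meson lessI less_SucI)
      ultimately have "g (i, Suc k) = g (k, Suc k)" by simp
      from indisc_column[OF g this that] have ?col by blast
      with 2(2) show False by blast
    qed
    have "inj_on (\<lambda>i. g (i, Suc i)) {0<..}"
      by (rule linorder_inj_onI') (use neq in auto)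
    moreover have "g (i, j) = g (i, Suc i)" if "i < j" for i j
      using 2(1) that by blast
    ultimately show ?thesis by (rule row)
  next
    case 3
    have neq: "g (0, j) \<noteq> g (0, k)" if "0 < j" "j < k" for j k
    proof
      assume "g (0, j) = g (0, k)"
      from indisc_row[OF g this that] have ?row by blast
      with 3(1) show False by blast
    qed
    have "inj_on (\<lambda>j. g (0, j)) {0<..}"
      by (rule linorder_inj_onI') (use neq in auto)
    moreover have "g (i, j) = g (0, j)" if "i < j" for i j
      using 3(2) that by (metis gr_zeroI not_less_zero)
    ultimately show ?thesis by (rule column)
  next
    case 4
    have row: "g (a, b) \<noteq> g (a, c)" if "a < b" "b < c" for a b c
      using indisc_row[OF g _ that] 4(1) by blast
    have col: "g (a, c) \<noteq> g (b, c)" if "a < b" "b < c" for a b c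
      using indisc_column[OF g _ that] 4(2) by blast
    \<comment> \<open>The index \<open>i\<close> differs from the other three and can be moved
      alone, which would produce a coincidence within a column.\<close>
    have diff: "g (i, j) \<noteq> g (k, l)" if "i < k" "i < j" "k < l" for i j k l
    proof
      assume "g (i, j) = g (k, l)"
      then have "g (2 * i, 2 * j) = g (2 * i + 1, 2 * j)"
        using that by (intro indisc_bump_fst[OF g]) auto
      then show False using col[of "2 * i" "2 * i + 1" "2 * j"] that by simp
    qed
    have "inj_on g up"
    proof (rule inj_onI)
      fix p q assume pq: "p \<in> up" "q \<in> up" "g p = g q"
      obtain i j k l where "p = (i, j)" "q = (k, l)" by (metis surj_pair)
      with pq show "p = q"
        using diff[of i k j l] diff[of k i l j] row[of i j l] row[of i l j]
        by (cases i k rule: linorder_cases; cases j l rule: linorder_cases) (auto simp: up_def)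
    qed
    then show ?thesis by (rule inj)
  qed
qed

section \<open>Index sequences and composition\<close>

lemma inj_on_up_subsequence:
  assumes "inj_on (\<lambda>(i, j). g (i, j)) up" "strict_mono (s :: nat \<Rightarrow> nat)"
  shows "inj_on (\<lambda>(i, j). g (s i, s j)) up"
proof (rule inj_onI)
  fix p q assume pq: "p \<in> up" "q \<in> up"
    "(case p of (i, j) \<Rightarrow> g (s i, s j)) = (case q of (i, j) \<Rightarrow> g (s i, s j))"
  obtain i j k l where ij: "p = (i, j)" "q = (k, l)" by (metis surj_pair)
  then have "(s i, s j) = (s k, s l)"
    using pq assms(2) by (intro inj_onD[OF assms(1)]) (auto simp: up_def strict_mono_less)
  then show "p = q" using ij assms(2) by (auto simp: strict_mono_eq)
qed

text \<open>The negation of membership in \<open>T2\<close>, with index sequences \<open>a\<close>, \<open>b\<close> in place of the sets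
  \<open>S1\<close>, \<open>S2\<close>. Nothing is required of \<open>a\<close> and \<open>b\<close>, because each
  disjunct forces them to be injective on the positive indices.\<close>

definition injective_somewhere :: "binop \<Rightarrow> bool" where
  "injective_somewhere f \<longleftrightarrow> (\<exists>a b :: nat \<Rightarrow> nat.
     inj_on (\<lambda>(i, j). f (a i, b j)) up \<or> inj_on (\<lambda>(i, j). f (a j, b i)) up)"

text \<open>After thinning, \<open>g\<close> and \<open>h\<close> are each injective on
  \<open>up\<close> or a function of one index. If both depend on the same index, the composition
  identifies two pairs; if they depend on different ones, these functions are index sequences for
  \<open>f\<close>.\<close>

lemma composition_inj_on_up:
  fixes f g h :: binop
  assumes inj: "inj_on (\<lambda>p. f (g p, h p)) up"
  obtains "injective_somewhere f"
    | s where "strict_mono s" "inj_on (\<lambda>(i, j). g (s i, s j)) up"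
    | s where "strict_mono s" "inj_on (\<lambda>(i, j). h (s i, s j)) up"
proof -
  obtain s where s: "strict_mono s" "indisc (\<lambda>(i, j). g (s i, s j))"
    by (rule indisc_subsequence)
  obtain t where t: "strict_mono t" "indisc (\<lambda>(i, j). (\<lambda>(i, j). h (s i, s j)) (t i, t j))"
    by (rule indisc_subsequence)
  define r where "r = s \<circ> t"
  have r: "strict_mono r" unfolding r_def using s(1) t(1) by (rule strict_mono_o)
  define G where "G = (\<lambda>(i, j). g (r i, r j))"
  define H where "H = (\<lambda>(i, j). h (r i, r j))"
  have inj': "inj_on (\<lambda>(i, j). f (G (i, j), H (i, j))) up"
    using inj_on_up_subsequence[of "\<lambda>p. f (g p, h p)", OF _ r] inj
    by (simp add: G_def H_def case_prod_unfold)
  \<comment> \<open>A constant counts as a function of either index. The canonical form is found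
    along \<open>s\<close> and then restricted along \<open>t\<close>.\<close>
  have G: "(\<exists>u. \<forall>i j. i < j \<longrightarrow> G (i, j) = u i) \<or> (\<exists>u. \<forall>i j. i < j \<longrightarrow> G (i, j) = u j) \<or>
      inj_on (\<lambda>(i, j). g (s i, s j)) up"
  proof -
    have "i < j \<Longrightarrow> t i < t j" for i j using t(1) by (simp add: strict_mono_less)
    then show ?thesis
      by (cases rule: erdos_rado_pairs[OF s(2)]) (fastforce simp: G_def r_def)+
  qed
  have H: "(\<exists>u. \<forall>i j. i < j \<longrightarrow> H (i, j) = u i) \<or> (\<exists>u. \<forall>i j. i < j \<longrightarrow> H (i, j) = u j) \<or>
      inj_on (\<lambda>(i, j). h (r i, r j)) up"
    by (cases rule: erdos_rado_pairs[OF t(2)]) (auto simp: H_def r_def)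
  from G H show ?thesis
  proof (elim disjE exE)
    fix u v assume "\<forall>i j. i < j \<longrightarrow> G (i, j) = u i" "\<forall>i j. i < j \<longrightarrow> H (i, j) = v i"
    then show ?thesis using inj_onD[OF inj', of "(0, 1)" "(0, 2)"] by (simp add: up_def)
  next
    fix u v assume "\<forall>i j. i < j \<longrightarrow> G (i, j) = u i" "\<forall>i j. i < j \<longrightarrow> H (i, j) = v j"
    then have "inj_on (\<lambda>(i, j). f (u i, v j)) up"
      using inj' by (subst (asm) inj_on_cong[of up _ "\<lambda>(i, j). f (u i, v j)"]) (auto simp: up_def)
    then show ?thesis using that(1) unfolding injective_somewhere_def by blast
  next
    fix u v assume "\<forall>i j. i < j \<longrightarrow> G (i, j) = u j" "\<forall>i j. i < j \<longrightarrow> H (i, j) = v i"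
    then have "inj_on (\<lambda>(i, j). f (u j, v i)) up"
      using inj' by (subst (asm) inj_on_cong[of up _ "\<lambda>(i, j). f (u j, v i)"]) (auto simp: up_def)
    then show ?thesis using that(1) unfolding injective_somewhere_def by blast
  next
    fix u v assume "\<forall>i j. i < j \<longrightarrow> G (i, j) = u j" "\<forall>i j. i < j \<longrightarrow> H (i, j) = v j"
    then show ?thesis using inj_onD[OF inj', of "(0, 2)" "(1, 2)"] by (simp add: up_def)
  qed (erule that(2)[OF s(1)] that(3)[OF r])+
qed

text \<open>The subsequence found for \<open>g\<close> or \<open>h\<close> is absorbed into
  \<open>a\<close> and \<open>b\<close>. The contrapositive yields closure of \<open>T2\<close>
  under composition.\<close>

lemma injective_somewhere_composition:
  assumes "injective_somewhere (\<lambda>(x, y). f (g (x, y), h (x, y)))"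
  shows "injective_somewhere f \<or> injective_somewhere g \<or> injective_somewhere h"
proof -
  obtain a b :: "nat \<Rightarrow> nat"
    where "inj_on (\<lambda>(i, j). f (g (a i, b j), h (a i, b j))) up \<or>
      inj_on (\<lambda>(i, j). f (g (a j, b i), h (a j, b i))) up"
    using assms unfolding injective_somewhere_def by auto
  then show ?thesis
  proof
    assume "inj_on (\<lambda>(i, j). f (g (a i, b j), h (a i, b j))) up"
    then have "inj_on (\<lambda>p. f ((\<lambda>(i, j). g (a i, b j)) p, (\<lambda>(i, j). h (a i, b j)) p)) up"
      by (simp add: case_prod_unfold)
    then show ?thesis
    proof (cases rule: composition_inj_on_up)
      case (2 s)
      then have "injective_somewhere g"
        unfolding injective_somewhere_def by (intro exI[of _ "a \<circ> s"] exI[of _ "b \<circ> s"]) simp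
      then show ?thesis by simp
    next
      case (3 s)
      then have "injective_somewhere h"
        unfolding injective_somewhere_def by (intro exI[of _ "a \<circ> s"] exI[of _ "b \<circ> s"]) simp
      then show ?thesis by simp
    qed simp
  next
    assume "inj_on (\<lambda>(i, j). f (g (a j, b i), h (a j, b i))) up"
    then have "inj_on (\<lambda>p. f ((\<lambda>(i, j). g (a j, b i)) p, (\<lambda>(i, j). h (a j, b i)) p)) up"
      by (simp add: case_prod_unfold)
    then show ?thesis
    proof (cases rule: composition_inj_on_up)
      case (2 s)
      then have "injective_somewhere g"
        unfolding injective_somewhere_def by (intro exI[of _ "a \<circ> s"] exI[of _ "b \<circ> s"]) simp
      then show ?thesis by simp
    next
      case (3 s)
      then have "injective_somewhere h"
        unfolding injective_somewhere_def by (intro exI[of _ "a \<circ> s"] exI[of _ "b \<circ> s"]) simp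
      then show ?thesis by simp
    qed simp
  qed
qed

text \<open>Injectivity leaves only finitely many bad choices at each stage, so both next values can
  be put above both present ones. For distinct indices, values of \<open>a\<close> and
  \<open>b\<close> then compare as their indices do.\<close>

lemma separated_subsequence:
  fixes a b :: "nat \<Rightarrow> nat"
  assumes "inj a" "inj b"
  shows "\<exists>s :: nat \<Rightarrow> nat. strict_mono s \<and> strict_mono (a \<circ> s) \<and> strict_mono (b \<circ> s) \<and>
    (\<forall>i j. i < j \<longrightarrow> a (s i) < b (s j) \<and> b (s i) < a (s j))"
proof -
  define Q where "Q n n' \<longleftrightarrow> n < n' \<and> max (a n) (b n) < min (a n') (b n')" for n n'
  have "\<exists>n'. Q n n'" for n
  proof -
    let ?K = "max (a n) (b n)"
    have "finite (a -` {..?K} \<union> b -` {..?K} \<union> {..n})"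
      using assms by (simp add: finite_vimageI)
    then have "\<exists>n'. n' \<notin> a -` {..?K} \<union> b -` {..?K} \<union> {..n}"
      by (rule ex_new_if_finite[OF infinite_UNIV_nat])
    then obtain n' where "n' \<notin> a -` {..?K} \<union> b -` {..?K} \<union> {..n}" ..
    then show ?thesis by (intro exI[of _ n']) (auto simp: Q_def)
  qed
  then have "\<exists>s. \<forall>n. True \<and> Q (s n) (s (Suc n))"
    by (intro dependent_nat_choice) auto
  then obtain s where s: "\<And>n. Q (s n) (s (Suc n))" by blast
  have mono: "strict_mono s" "strict_mono (a \<circ> s)" "strict_mono (b \<circ> s)"
    using s by (auto simp: strict_mono_Suc_iff Q_def)
  have "a (s i) < b (s j) \<and> b (s i) < a (s j)" if "i < j" for i j
  proof -
    have "a (s (Suc i)) \<le> a (s j)" "b (s (Suc i)) \<le> b (s j)"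
      using mono(2,3)[THEN strict_mono_leD, of "Suc i" j] that by simp_all
    then show ?thesis using s[of i] by (auto simp: Q_def)
  qed
  with mono show ?thesis by blast
qed

text \<open>If the values were equal, one index of the increasing pair would differ from the three
  others: \<open>i\<close> when \<open>i \<noteq> k\<close>, and otherwise \<open>j\<close>. Moving
  it alone contradicts injectivity on \<open>up\<close>.\<close>

lemma indisc_disjoint:
  assumes g: "indisc g" and inj: "inj_on g up"
    and "i < j" "l < k" "i \<noteq> l" "j \<noteq> k"
  shows "g (i, j) \<noteq> g (k, l)"
proof
  assume eq: "g (i, j) = g (k, l)"
  show False
  proof (cases "i = k")
    case False
    then have "g (2 * i, 2 * j) = g (2 * i + 1, 2 * j)"
      using assms(3-) by (intro indisc_bump_fst[OF g eq]) auto
    then show False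
      using inj_onD[OF inj, of "(2 * i, 2 * j)" "(2 * i + 1, 2 * j)"] assms(3) by (simp add: up_def)
  next
    case True
    then have "g (2 * i, 2 * j) = g (2 * i, 2 * j + 1)"
      using assms(3-) by (intro indisc_bump_snd[OF g eq]) auto
    then show False
      using inj_onD[OF inj, of "(2 * i, 2 * j)" "(2 * i, 2 * j + 1)"] assms(3) by (simp add: up_def)
  qed
qed

text \<open>First coordinates use even and second coordinates odd indices. No index then occurs in
  both roles, so \<open>indisc_disjoint\<close> makes the two ranges disjoint, while
  \<open>erdos_rado_pairs\<close> gives the canonical form on each triangle.\<close>

lemma indiscernible_canonical_on:
  fixes f :: binop and a b :: "nat \<Rightarrow> nat"
  assumes a: "strict_mono a" and b: "strict_mono b"
    and ab: "\<And>i j. i < j \<Longrightarrow> a i < b j" "\<And>i j. i < j \<Longrightarrow> b i < a j"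
    and g: "indisc (\<lambda>(i, j). f (a i, b j))"
    and inj: "inj_on (\<lambda>(i, j). f (a i, b j)) up \<or> inj_on (\<lambda>(i, j). f (a j, b i)) up"
  shows "\<exists>S1 S2. canonical_on S1 S2 f \<and> (inj_on f (Delta S1 S2) \<or> inj_on f (Nabla S1 S2))"
proof -
  \<comment> \<open>0 is left out because the canonical forms guarantee injectivity only on positive
    indices.\<close>
  define E where "E = {i::nat. even i \<and> 0 < i}"
  define D where "D = {j::nat. odd j}"
  have neq: "i \<noteq> j" if "i \<in> E" "j \<in> D" for i j using that by (auto simp: E_def D_def)
  have pos: "0 < i" if "i \<in> E \<union> D" for i using that by (auto simp: E_def D_def odd_pos)
  have "infinite (range (\<lambda>n::nat. 2 * n + 2))" "infinite (range (\<lambda>n::nat. 2 * n + 1))"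
    by (auto intro!: range_inj_infinite injI)
  moreover have "range (\<lambda>n::nat. 2 * n + 2) \<subseteq> E" "range (\<lambda>n::nat. 2 * n + 1) \<subseteq> D"
    by (auto simp: E_def D_def)
  ultimately have infED: "infinite E" "infinite D" by (auto dest: finite_subset)
  have inja: "inj a" "inj b" using a b by (auto simp: strict_mono_imp_inj_on)
  have inf: "infinite (a ` E)" "infinite (b ` D)"
    using infED inja by (auto dest!: finite_imageD intro: inj_on_subset)
  have nabla: "\<exists>i j. p = (a i, b j) \<and> i \<in> E \<and> j \<in> D \<and> i < j" if p: "p \<in> Nabla (a ` E) (b ` D)" for p
  proof -
    obtain i j where ij: "p = (a i, b j)" "i \<in> E" "j \<in> D" "a i < b j"
      using p by (auto simp: Nabla_def)
    then have "i < j" using neq[of i j] ab(2)[of j i] by (meson linorder_neqE_nat order.asym)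
    then show ?thesis using ij by blast
  qed
  have delta: "\<exists>i j. p = (a i, b j) \<and> i \<in> E \<and> j \<in> D \<and> j < i" if p: "p \<in> Delta (a ` E) (b ` D)" for p
  proof -
    obtain i j where ij: "p = (a i, b j)" "i \<in> E" "j \<in> D" "a i > b j"
      using p by (auto simp: Delta_def)
    then have "j < i" using neq[of i j] ab(1)[of i j] by (meson linorder_neqE_nat order.asym)
    then show ?thesis using ij by blast
  qed
  have inj_inv: "inj_on (G \<circ> inv c) (c ` X)"
    if G: "inj_on G {0<..}" "inj c" "X \<subseteq> E \<union> D" for G c :: "nat \<Rightarrow> nat" and X
  proof (rule inj_onI)
    fix x y assume "x \<in> c ` X" "y \<in> c ` X" and eq: "(G \<circ> inv c) x = (G \<circ> inv c) y"
    then obtain i j where ij: "x = c i" "i \<in> X" "y = c j" "j \<in> X" by blast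
    then have "G i = G j" using eq G(2) by simp
    then show "x = y" using inj_onD[OF G(1), of i j] ij pos G(3) by auto
  qed
  let ?g = "\<lambda>(i, j). f (a i, b j)" and ?h = "\<lambda>(i, j). f (a j, b i)"
  have h: "indisc ?h" using indisc_transpose[OF g] by (simp add: case_prod_unfold)
  have injN: "inj_on f (Nabla (a ` E) (b ` D))" if "inj_on ?g up"
  proof (rule inj_onI)
    fix p q assume pq: "p \<in> Nabla (a ` E) (b ` D)" "q \<in> Nabla (a ` E) (b ` D)" "f p = f q"
    obtain i j k l where "p = (a i, b j)" "i < j" "q = (a k, b l)" "k < l"
      using nabla[OF pq(1)] nabla[OF pq(2)] by blast
    then show "p = q" using inj_onD[OF that, of "(i, j)" "(k, l)"] pq(3) by (simp add: up_def)
  qed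
  have injD: "inj_on f (Delta (a ` E) (b ` D))" if "inj_on ?h up"
  proof (rule inj_onI)
    fix p q assume pq: "p \<in> Delta (a ` E) (b ` D)" "q \<in> Delta (a ` E) (b ` D)" "f p = f q"
    obtain i j k l where "p = (a i, b j)" "j < i" "q = (a k, b l)" "l < k"
      using delta[OF pq(1)] delta[OF pq(2)] by blast
    then show "p = q" using inj_onD[OF that, of "(j, i)" "(l, k)"] pq(3) by (simp add: up_def)
  qed
  have "canonical (a ` E) (b ` D) (Nabla (a ` E) (b ` D)) f"
  proof (cases rule: erdos_rado_pairs[OF g])
    case (1 c)
    then have "\<forall>(x, y) \<in> Nabla (a ` E) (b ` D). f (x, y) = c" by (auto dest!: nabla)
    then show ?thesis unfolding canonical_def by blast
  next
    case (2 G)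
    then have "\<forall>(x, y) \<in> Nabla (a ` E) (b ` D). f (x, y) = (G \<circ> inv a) x"
      using inja by (auto dest!: nabla)
    then show ?thesis
      unfolding canonical_def using inj_inv[OF 2(1) inja(1), of E] by blast
  next
    case (3 G)
    then have "\<forall>(x, y) \<in> Nabla (a ` E) (b ` D). f (x, y) = (G \<circ> inv b) y"
      using inja by (auto dest!: nabla)
    then show ?thesis
      unfolding canonical_def using inj_inv[OF 3(1) inja(2), of D] by blast
  next
    case 4
    then show ?thesis unfolding canonical_def using injN by blast
  qed
  moreover have "canonical (a ` E) (b ` D) (Delta (a ` E) (b ` D)) f"
  proof (cases rule: erdos_rado_pairs[OF h])
    case (1 c)
    then have "\<forall>(x, y) \<in> Delta (a ` E) (b ` D). f (x, y) = c" by (auto dest!: delta)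
    then show ?thesis unfolding canonical_def by blast
  next
    \<comment> \<open>In \<open>?h\<close> the smaller index belongs to \<open>b\<close>, so the row
      form becomes dependence on \<open>y\<close>, and the column form dependence on
      \<open>x\<close>.\<close>
    case (2 G)
    then have "\<forall>(x, y) \<in> Delta (a ` E) (b ` D). f (x, y) = (G \<circ> inv b) y"
      using inja by (auto dest!: delta)
    then show ?thesis
      unfolding canonical_def using inj_inv[OF 2(1) inja(2), of D] by blast
  next
    case (3 G)
    then have "\<forall>(x, y) \<in> Delta (a ` E) (b ` D). f (x, y) = (G \<circ> inv a) x"
      using inja by (auto dest!: delta)
    then show ?thesis
      unfolding canonical_def using inj_inv[OF 3(1) inja(1), of E] by blast
  next
    case 4
    then show ?thesis unfolding canonical_def using injD by blast
  qed
  moreover have "f p \<noteq> f q" if pq: "p \<in> Delta (a ` E) (b ` D)" "q \<in> Nabla (a ` E) (b ` D)" for p q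
  proof -
    obtain i j k l where p: "p = (a k, b l)" "k \<in> E" "l \<in> D" "l < k"
      and q: "q = (a i, b j)" "i \<in> E" "j \<in> D" "i < j"
      using delta[OF pq(1)] nabla[OF pq(2)] by blast
    have ne: "i \<noteq> l" "j \<noteq> k" using neq p q by blast+
    from inj show ?thesis
    proof
      assume "inj_on ?g up"
      from indisc_disjoint[OF g this q(4) p(4) ne] show ?thesis using p q by simp
    next
      assume "inj_on ?h up"
      from indisc_disjoint[OF h this p(4) q(4) ne[symmetric]] show ?thesis using p q by simp
    qed
  qed
  then have "f ` Delta (a ` E) (b ` D) \<inter> f ` Nabla (a ` E) (b ` D) = {}" by blast
  ultimately have "canonical_on (a ` E) (b ` D) f" using inf by (simp add: canonical_on_def)
  then show ?thesis using injN injD inj by blast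
qed

text \<open>Injectivity on \<open>up\<close> survives the passage to subsequences, so
  \<open>a\<close> and \<open>b\<close> can be thinned until they are strictly increasing,
  interleaved and indiscernible; \<open>indiscernible_canonical_on\<close> then supplies the
  sets.\<close>

lemma injective_somewhere_imp_notin_T2:
  assumes "injective_somewhere f"
  shows "f \<notin> T2"
proof -
  obtain a b where inj: "inj_on (\<lambda>(i, j). f (a i, b j)) up \<or> inj_on (\<lambda>(i, j). f (a j, b i)) up"
    using assms unfolding injective_somewhere_def by blast
  have sub: "inj_on (\<lambda>(i, j). f (a (s i), b (s j))) up \<or> inj_on (\<lambda>(i, j). f (a (s j), b (s i))) up"
    if "strict_mono s" for s
    using inj inj_on_up_subsequence[of "\<lambda>(i, j). f (a i, b j)" s]
      inj_on_up_subsequence[of "\<lambda>(i, j). f (a j, b i)" s] that by auto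
  \<comment> \<open>The common partner \<open>Suc j\<close> separates the values of one sequence,
    the common partner 0 those of the other. The latter needs positive indices, whence the shift by
    \<open>Suc\<close> below.\<close>
  have "a i \<noteq> a j \<and> b i \<noteq> b j" if "0 < i" "i < j" for i j
    using inj
  proof
    assume "inj_on (\<lambda>(i, j). f (a i, b j)) up"
    from inj_onD[OF this, of "(i, Suc j)" "(j, Suc j)"] inj_onD[OF this, of "(0, i)" "(0, j)"]
    show ?thesis using that by (auto simp: up_def)
  next
    assume "inj_on (\<lambda>(i, j). f (a j, b i)) up"
    from inj_onD[OF this, of "(i, Suc j)" "(j, Suc j)"] inj_onD[OF this, of "(0, i)" "(0, j)"]
    show ?thesis using that by (auto simp: up_def)
  qed
  then have "inj (a \<circ> Suc)" "inj (b \<circ> Suc)"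
    by (auto intro!: linorder_inj_onI')
  from separated_subsequence[OF this] obtain s :: "nat \<Rightarrow> nat" where s: "strict_mono s"
    "strict_mono (a \<circ> Suc \<circ> s)" "strict_mono (b \<circ> Suc \<circ> s)"
    "\<And>i j. i < j \<Longrightarrow> a (Suc (s i)) < b (Suc (s j)) \<and> b (Suc (s i)) < a (Suc (s j))"
    by (auto simp: o_assoc)
  obtain t where t: "strict_mono t"
    "indisc (\<lambda>(i, j). (\<lambda>(i, j). f (a (Suc (s i)), b (Suc (s j)))) (t i, t j))"
    by (rule indisc_subsequence)
  define r where "r = Suc \<circ> s \<circ> t"
  have r: "strict_mono r" unfolding r_def using s(1) t(1) by (auto simp: strict_mono_def)
  have mono: "strict_mono (a \<circ> r)" "strict_mono (b \<circ> r)"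
    using strict_mono_o[OF s(2) t(1)] strict_mono_o[OF s(3) t(1)] by (simp_all add: r_def o_assoc)
  have "\<exists>S1 S2. canonical_on S1 S2 f \<and> (inj_on f (Delta S1 S2) \<or> inj_on f (Nabla S1 S2))"
  proof (rule indiscernible_canonical_on[OF mono])
    show "(a \<circ> r) i < (b \<circ> r) j" "(b \<circ> r) i < (a \<circ> r) j" if "i < j" for i j
      using s(4)[of "t i" "t j"] t(1) that by (auto simp: r_def strict_mono_less)
    show "indisc (\<lambda>(i, j). f ((a \<circ> r) i, (b \<circ> r) j))" using t(2) by (simp add: r_def)
  qed (use sub[OF r] in simp)
  then show ?thesis by (auto simp: T2_def nowhere_injective_def)
qed

text \<open>Enumerations of \<open>S1\<close> and \<open>S2\<close>, thinned until values compare as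
  their indices do, send pairs \<open>i < j\<close> into \<open>Nabla S1 S2\<close>, and with
  exchanged roles into \<open>Delta S1 S2\<close>.\<close>

lemma notin_T2_imp_injective_somewhere:
  assumes "f \<notin> T2"
  shows "injective_somewhere f"
proof -
  obtain S1 S2 where S: "infinite S1" "infinite S2"
    and inj: "inj_on f (Delta S1 S2) \<or> inj_on f (Nabla S1 S2)"
    using assms unfolding T2_def nowhere_injective_def canonical_on_def by blast
  have "inj (enumerate S1)" "inj (enumerate S2)"
    using S by (auto intro: strict_mono_imp_inj_on strict_mono_enumerate)
  from separated_subsequence[OF this] obtain s :: "nat \<Rightarrow> nat" where s: "strict_mono (enumerate S1 \<circ> s)"
    "strict_mono (enumerate S2 \<circ> s)"
    "\<And>i j. i < j \<Longrightarrow> enumerate S1 (s i) < enumerate S2 (s j) \<and> enumerate S2 (s i) < enumerate S1 (s j)"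
    by blast
  define a b where "a = enumerate S1 \<circ> s" and "b = enumerate S2 \<circ> s"
  have ab: "inj a" "inj b" "\<And>i. a i \<in> S1" "\<And>i. b i \<in> S2"
    using s(1,2) S by (auto simp: a_def b_def enumerate_in_set intro: strict_mono_imp_inj_on)
  have less: "a i < b j" "b i < a j" if "i < j" for i j
    using s(3)[OF that] by (simp_all add: a_def b_def)
  from inj show ?thesis
  proof
    assume D: "inj_on f (Delta S1 S2)"
    have "inj_on (\<lambda>(i, j). f (a j, b i)) up"
    proof (rule inj_onI, clarify)
      fix i j k l assume "(i, j) \<in> up" "(k, l) \<in> up" and eq: "f (a j, b i) = f (a l, b k)"
      then have "(a j, b i) \<in> Delta S1 S2" "(a l, b k) \<in> Delta S1 S2"
        using ab less by (auto simp: up_def Delta_def)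
      from inj_onD[OF D eq this] show "i = k \<and> j = l" using ab by (auto dest: injD)
    qed
    then show ?thesis unfolding injective_somewhere_def by blast
  next
    assume N: "inj_on f (Nabla S1 S2)"
    have "inj_on (\<lambda>(i, j). f (a i, b j)) up"
    proof (rule inj_onI, clarify)
      fix i j k l assume "(i, j) \<in> up" "(k, l) \<in> up" and eq: "f (a i, b j) = f (a k, b l)"
      then have "(a i, b j) \<in> Nabla S1 S2" "(a k, b l) \<in> Nabla S1 S2"
        using ab less by (auto simp: up_def Nabla_def)
      from inj_onD[OF N eq this] show "i = k \<and> j = l" using ab by (auto dest: injD)
    qed
    then show ?thesis unfolding injective_somewhere_def by blast
  qed
qed

lemma T2_iff: "f \<in> T2 \<longleftrightarrow> \<not> injective_somewhere f"
  using injective_somewhere_imp_notin_T2[of f] notin_T2_imp_injective_somewhere[of f] by blast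

lemma compositions_T2: "compositions T2 \<subseteq> T2"
proof
  fix F assume "F \<in> compositions T2"
  then obtain f g h where "F = (\<lambda>(x, y). f (g (x, y), h (x, y)))" "f \<in> T2" "g \<in> T2" "h \<in> T2"
    unfolding compositions_def by blast
  then show "F \<in> T2" using injective_somewhere_composition[of f g h] T2_iff by blast
qed

section \<open>The nowhere injective operations are not analytic\<close>

text \<open>The reduction of well-foundedness: for a tree \<open>T\<close> of finite sequences, this operation lies in
  \<open>T2\<close> exactly if \<open>T\<close> has no infinite branch.\<close>

definition prefix_binop :: "nat list set \<Rightarrow> binop" where
  "prefix_binop T = (\<lambda>(x, y).
     if strict_prefix (list_decode x) (list_decode y) \<and> list_decode y \<in> T
     then Suc (prod_encode (x, y)) else 0)"

text \<open>The codes of the initial segments of the branch serve as both index sequences; these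
  segments are nested, so the value is an injective code of the pair.\<close>

lemma branch_imp_injective_somewhere:
  assumes "\<And>n. map z [0..<n] \<in> T"
  shows "injective_somewhere (prefix_binop T)"
proof -
  define a where "a n = list_encode (map z [0..<n])" for n
  have a: "a i = a j \<longleftrightarrow> i = j" for i j
  proof
    assume "a i = a j"
    then have "length (map z [0..<i]) = length (map z [0..<j])"
      unfolding a_def by (metis list_encode_inverse)
    then show "i = j" by simp
  qed simp
  have "prefix_binop T (a i, a j) = Suc (prod_encode (a i, a j))" if "i < j" for i j
  proof -
    have "[0..<j] = [0..<i] @ [i..<j]"
      using that upt_add_eq_append[of 0 i "j - i"] by simp
    then have "map z [0..<j] = map z [0..<i] @ map z [i..<j]"
      by (metis map_append)
    then have "strict_prefix (map z [0..<i]) (map z [0..<j])"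
      using that by (simp add: strict_prefix_def)
    then show ?thesis using assms by (simp add: prefix_binop_def a_def)
  qed
  then have "inj_on (\<lambda>(i, j). prefix_binop T (a i, a j)) up"
    by (auto intro!: inj_onI simp: up_def a)
  then show ?thesis unfolding injective_somewhere_def by blast
qed

text \<open>In the first orientation any two late \<open>A i\<close> are prefixes of a common later
  \<open>B j\<close>, hence comparable, and injectivity makes their lengths unbounded; their union
  is a branch.\<close>

lemma injective_somewhere_imp_branch:
  assumes inj: "injective_somewhere (prefix_binop T)"
    and closed: "\<And>s t. prefix s t \<Longrightarrow> t \<in> T \<Longrightarrow> s \<in> T"
  shows "\<exists>z. \<forall>n. map z [0..<n] \<in> T"
proof -
  \<comment> \<open>An injective map takes the value 0 at most once on \<open>up\<close>, hence at
    no late pair.\<close>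
  have nonzero: "\<exists>N. \<forall>i j. N \<le> i \<and> i < j \<longrightarrow> g (i, j) \<noteq> 0" if "inj_on g up" for g :: binop
  proof (cases "\<exists>i j. i < j \<and> g (i, j) = 0")
    case True
    then obtain i0 j0 where 0: "i0 < j0" "g (i0, j0) = 0" by blast
    have "g (i, j) \<noteq> 0" if "j0 \<le> i" "i < j" for i j
      using inj_onD[OF \<open>inj_on g up\<close>, of "(i, j)" "(i0, j0)"] 0 that by (auto simp: up_def)
    then show ?thesis by blast
  next
    case False
    then show ?thesis by (intro exI[of _ 0]) auto
  qed
  obtain a b where "inj_on (\<lambda>(i, j). prefix_binop T (a i, b j)) up
      \<or> inj_on (\<lambda>(i, j). prefix_binop T (a j, b i)) up"
    using inj unfolding injective_somewhere_def by blast
  then show ?thesis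
  proof
    assume I: "inj_on (\<lambda>(i, j). prefix_binop T (a i, b j)) up"
    have "\<exists>N. \<forall>i j. N \<le> i \<and> i < j \<longrightarrow> prefix_binop T (a i, b j) \<noteq> 0"
      using nonzero[OF I] by simp
    then obtain N where N: "\<forall>i j. N \<le> i \<and> i < j \<longrightarrow> prefix_binop T (a i, b j) \<noteq> 0" ..
    define A B where "A = list_decode \<circ> a" and "B = list_decode \<circ> b"
    have pre: "prefix (A i) (B j)" "B j \<in> T" if "N \<le> i" "i < j" for i j
      using N[rule_format, of i j] that
      by (auto simp: prefix_binop_def A_def B_def strict_prefix_def split: if_splits)
    have comparable: "prefix (A i) (A j) \<or> prefix (A j) (A i)" if "N \<le> i" "N \<le> j" for i j
      using prefix_same_cases[OF pre(1)[of i "i + Suc j"] pre(1)[of j "i + Suc j"]] that by simp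
    have "inj_on (\<lambda>i. length (A i)) {N..}"
    proof (rule linorder_inj_onI')
      fix i j assume "i \<in> {N..}" "j \<in> {N..}" "i < j"
      then have "A i \<noteq> A j"
        using inj_onD[OF I, of "(i, Suc j)" "(j, Suc j)"]
        by (auto simp: A_def up_def list_decode_eq)
      then show "length (A i) \<noteq> length (A j)"
        using comparable[of i j] \<open>i \<in> {N..}\<close> \<open>j \<in> {N..}\<close> by (auto simp: prefix_def)
    qed
    then have "infinite ((\<lambda>i. length (A i)) ` {N..})"
      using finite_imageD infinite_Ici by blast
    then have "\<forall>n. \<exists>i. N \<le> i \<and> n \<le> length (A i)"
      by (auto simp: infinite_nat_iff_unbounded_le)
    then obtain c where c: "\<And>n. N \<le> c n" "\<And>n. n \<le> length (A (c n))" by metis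
    \<comment> \<open>Entry \<open>k\<close> is read off a node of length at least
      \<open>k + 1\<close>; by comparability all such nodes agree there.\<close>
    define z where "z k = A (c (Suc k)) ! k" for k
    have "map z [0..<n] \<in> T" for n
    proof (rule closed)
      have "map z [0..<n] = take n (A (c n))"
      proof (rule nth_equalityI)
        fix k assume "k < length (map z [0..<n])"
        then have k: "k < n" by simp
        have "A (c (Suc k)) ! k = A (c n) ! k"
          using comparable[OF c(1) c(1), of "Suc k" n] c(2)[of "Suc k"] c(2)[of n] k
          by (auto simp: prefix_def nth_append)
        then show "map z [0..<n] ! k = take n (A (c n)) ! k" using k by (simp add: z_def)
      qed (use c(2)[of n] in simp)
      then show "prefix (map z [0..<n]) (B (Suc (c n)))"
        using pre(1)[OF c(1) lessI, of n] take_is_prefix by (metis prefix_order.trans)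
      show "B (Suc (c n)) \<in> T" using pre(2)[OF c(1) lessI] .
    qed
    then show ?thesis by blast
  next
    \<comment> \<open>In this orientation the single sequence \<open>list_decode (b N)\<close> would
      have infinitely many prefixes.\<close>
    assume I: "inj_on (\<lambda>(i, j). prefix_binop T (a j, b i)) up"
    have "\<exists>N. \<forall>i j. N \<le> i \<and> i < j \<longrightarrow> prefix_binop T (a j, b i) \<noteq> 0"
      using nonzero[OF I] by simp
    then obtain N where N: "\<forall>i j. N \<le> i \<and> i < j \<longrightarrow> prefix_binop T (a j, b i) \<noteq> 0" ..
    have "list_decode (a j) \<in> set (prefixes (list_decode (b N)))" if "N < j" for j
      using N[rule_format, of N j] that
      by (auto simp: prefix_binop_def strict_prefix_def split: if_splits)
    then have "(list_decode \<circ> a) ` {N<..} \<subseteq> set (prefixes (list_decode (b N)))" by auto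
    moreover have "inj_on (list_decode \<circ> a) {N<..}"
    proof (rule linorder_inj_onI')
      fix i j assume "i \<in> {N<..}" "j \<in> {N<..}" "i < j"
      then show "(list_decode \<circ> a) i \<noteq> (list_decode \<circ> a) j"
        using inj_onD[OF I, of "(N, i)" "(N, j)"] by (auto simp: up_def list_decode_eq)
    qed
    ultimately have "finite {N<..}" by (meson finite_imageD finite_set finite_subset)
    then show ?thesis using infinite_Ioi[of N] by blast
  qed
qed

section \<open>Diagonalization over trees\<close>

primrec level :: "(nat list \<Rightarrow> nat list set \<Rightarrow> bool) \<Rightarrow> nat \<Rightarrow> nat list set" where
  "level P 0 = {}"
| "level P (Suc n) = level P n \<union> {s. length s = n \<and> P s (level P n)}"

text \<open>\<open>level P n\<close> is the part of the solution consisting of sequences shorter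
  than \<open>n\<close>. Membership of \<open>s\<close> refers only to shorter sequences, so the
  stages are consistent and their union solves the equation.\<close>

lemma level_recursion:
  fixes P :: "nat list \<Rightarrow> nat list set \<Rightarrow> bool"
  shows "\<exists>T. \<forall>s. s \<in> T \<longleftrightarrow> P s {t \<in> T. length t < length s}"
proof (intro exI allI)
  fix s :: "nat list"
  have mem: "s \<in> level P n \<longleftrightarrow> length s < n \<and> P s (level P (length s))" for n s
    by (induction n) (auto simp: less_Suc_eq)
  have T: "s \<in> (\<Union>n. level P n) \<longleftrightarrow> P s (level P (length s))" for s
    using mem[of s] by auto
  have "{t \<in> \<Union>n. level P n. length t < n} = level P n" for n
    using mem[of _ n] T by blast
  then show "s \<in> (\<Union>n. level P n) \<longleftrightarrow> P s {t \<in> \<Union>n. level P n. length t < length s}"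
    using T by simp
qed

text \<open>If the operation of the diagonal tree is in \<open>T2\<close>, a witness of this is a
  branch, which puts it outside \<open>T2\<close>. If it is not in \<open>T2\<close>, the tree has a
  branch, and this branch is a witness that it is in \<open>T2\<close>.\<close>

lemma not_analytic_T2: "\<not> analytic T2"
proof
  assume "analytic T2"
  then obtain F :: "(binop \<times> (nat \<Rightarrow> nat)) set"
    where "closed F \<and> (\<forall>f. f \<in> T2 \<longleftrightarrow> (\<exists>z. (f, z) \<in> F))"
    using analyticD[OF \<open>analytic T2\<close>] by (elim exE)
  then have F: "closed F" "\<And>f. f \<in> T2 \<longleftrightarrow> (\<exists>z. (f, z) \<in> F)" by auto
  \<comment> \<open>A fixed point \<open>T\<close> of this condition is a tree whose infinite branches are exactly the \<open>z\<close>
    witnessing \<open>prefix_binop T \<in> T2\<close>.\<close>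
  define P where "P s L \<longleftrightarrow> (\<exists>T z. {t \<in> T. length t < length s} = L \<and> map z [0..<length s] = s \<and>
    (prefix_binop T, z) \<in> F)" for s L
  obtain T where T: "\<forall>s. s \<in> T \<longleftrightarrow> P s {t \<in> T. length t < length s}"
    using level_recursion ..
  \<comment> \<open>The tree and the witness behind \<open>t\<close> also serve for its prefix
    \<open>s\<close>, since agreement below \<open>length t\<close> includes agreement below
    \<open>length s\<close>.\<close>
  have closed: "s \<in> T" if st: "prefix s t" "t \<in> T" for s t
  proof -
    obtain T' z where T': "{u \<in> T'. length u < length t} = {u \<in> T. length u < length t}"
      "map z [0..<length t] = t" "(prefix_binop T', z) \<in> F"
      using st(2) T[rule_format, of t] unfolding P_def by blast
    have same: "u \<in> T' \<longleftrightarrow> u \<in> T" if "length u < length t" for u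
      using arg_cong[OF T'(1), of "\<lambda>X. u \<in> X"] that by simp
    have le: "length s \<le> length t" using st(1) by (rule prefix_length_le)
    have "{u \<in> T'. length u < length s} = {u \<in> T. length u < length s}"
      using same le by auto
    moreover have "map z [0..<length s] = s"
    proof -
      have "s = take (length s) t" using st(1) by (auto simp: prefix_def)
      also have "\<dots> = map z [0..<length s]" using le by (subst T'(2)[symmetric]) (simp add: take_map)
      finally show ?thesis by simp
    qed
    ultimately have "P s {u \<in> T. length u < length s}" using T'(3) unfolding P_def by blast
    then show ?thesis using T[rule_format, of s] by blast
  qed
  \<comment> \<open>Each value of \<open>prefix_binop T\<close> depends on \<open>T\<close> only up to some length, so the witnesses along the
    branch converge to \<open>(prefix_binop T, z)\<close>, which lies in the closed set \<open>F\<close>.\<close>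
  have "prefix_binop T \<in> T2" if z: "\<And>n. map z [0..<n] \<in> T" for z
  proof -
    have "\<forall>n. \<exists>S w. {t \<in> S. length t < n} = {t \<in> T. length t < n} \<and>
        map w [0..<n] = map z [0..<n] \<and> (prefix_binop S, w) \<in> F" (is "\<forall>n. \<exists>S w. ?A n S w")
    proof
      fix n
      show "\<exists>S w. ?A n S w"
        using z[of n] T[rule_format, of "map z [0..<n]"] by (simp add: P_def)
    qed
    then have "\<exists>S. \<forall>n. \<exists>w. ?A n (S n) w" by (rule choice)
    then obtain S where "\<forall>n. \<exists>w. ?A n (S n) w" ..
    then have "\<exists>w. \<forall>n. ?A n (S n) (w n)" by (rule choice)
    then obtain w where "\<forall>n. ?A n (S n) (w n)" ..
    then have S: "\<And>n. {t \<in> S n. length t < n} = {t \<in> T. length t < n}"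
      and w: "\<And>n. map (w n) [0..<n] = map z [0..<n]" and SF: "\<And>n. (prefix_binop (S n), w n) \<in> F"
      by blast+
    have "(prefix_binop T, z) \<in> F"
    proof (rule closed_pairsD[OF F(1) SF])
      fix p :: "nat \<times> nat"
      obtain x y where p: "p = (x, y)" by (metis surj_pair)
      have "list_decode y \<in> S n \<longleftrightarrow> list_decode y \<in> T" if "Suc (length (list_decode y)) \<le> n" for n
        using arg_cong[OF S[of n], of "\<lambda>X. list_decode y \<in> X"] that by simp
      then show "\<forall>\<^sub>F n in sequentially. prefix_binop (S n) p = prefix_binop T p"
        unfolding p prefix_binop_def
        by (intro eventually_sequentiallyI[of "Suc (length (list_decode y))"]) simp
    next
      fix k
      have "w n k = z k" if "Suc k \<le> n" for n
        using arg_cong[OF w[of n], of "\<lambda>xs. xs ! k"] that by simp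
      then show "\<forall>\<^sub>F n in sequentially. w n k = z k"
        by (rule eventually_sequentiallyI)
    qed
    then show ?thesis using F(2) by blast
  qed
  moreover have "prefix_binop T \<notin> T2" if "\<And>n. map z [0..<n] \<in> T" for z
    using branch_imp_injective_somewhere[of z T] that by (simp add: T2_iff)
  moreover have "\<exists>z. \<forall>n. map z [0..<n] \<in> T" if T2: "prefix_binop T \<in> T2"
  proof -
    obtain z where z: "(prefix_binop T, z) \<in> F" using T2 F(2) by blast
    \<comment> \<open>At every length, \<open>T\<close> itself can be taken as the tree required by
      \<open>P\<close>.\<close>
    have "map z [0..<n] \<in> T" for n
      using z unfolding T[rule_format, of "map z [0..<n]"] P_def by auto
    then show ?thesis by blast
  qed
  moreover have "\<exists>z. \<forall>n. map z [0..<n] \<in> T" if "prefix_binop T \<notin> T2"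
    using injective_somewhere_imp_branch[of T] that closed by (auto simp: T2_iff)
  ultimately show False by blast
qed

section \<open>Adjoining one operation to an analytic clone\<close>

theorem mainTheorem7:
  fixes C :: "binop set"
  assumes "binary_clone C"
    and "essentially_unary \<subseteq> C"
    and "C \<subseteq> T2"
    and "C \<in> sets borel \<or> analytic_set C"
  shows "\<not> coatom_of_clone_interval essentially_unary T2 C"
proof
  assume coatom: "coatom_of_clone_interval essentially_unary T2 C"
  then obtain f where f: "f \<in> T2" "f \<notin> C"
    using assms(3) by (auto simp: coatom_of_clone_interval_def)
  let ?D = "\<Union>n. generated (C \<union> {f}) n"
  have "analytic C" using assms(4) borel_imp_analytic analytic_set_imp_analytic by blast
  moreover have "analytic {f}"
  proof (rule closed_imp_analytic)
    have "closed (\<Inter>p. {g. g p = f p})"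
      by (intro closed_INT ballI closed_Collect_eq continuous_on_product_coordinates continuous_on_const)
    moreover have "(\<Inter>p. {g. g p = f p}) = {f}" by auto
    ultimately show "closed {f}" by simp
  qed
  ultimately have "analytic ?D" by (intro analytic_UN analytic_generated analytic_Un)
  then have "?D \<noteq> T2" using not_analytic_T2 by auto
  moreover have "C \<union> {f} \<subseteq> ?D" using generated.simps(1)[of "C \<union> {f}"] by blast
  moreover have "?D \<subseteq> T2" using generated_subset[OF _ compositions_T2] f(1) assms(3) by blast
  moreover have "binary_clone ?D"
    using assms(1) by (intro binary_clone_generated) (auto simp: binary_clone_def)
  ultimately have "?D \<in> clone_interval essentially_unary T2 - {T2}"
    using assms(2) by (auto simp: clone_interval_def)
  then have "?D = C"
    using coatom \<open>C \<union> {f} \<subseteq> ?D\<close> unfolding coatom_of_clone_interval_def by blast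
  then show False using \<open>C \<union> {f} \<subseteq> ?D\<close> f(2) by blast
qed

end
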